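(* Let $X$ be the simplicial complex on vertex set $\{0,1,\dots,9\}$ with the $14$ facets $$1249,\ 1269,\ 1569,\ 1589,\ 1489,\ 1458,\ 1457,\ 4578,\ 1256,\ 0125,\ 0256,\ 0123,\ 1234,\ 1347,$$ let $A$ be its subcomplex with facets $026,\ 023,\ 234,\ 347,\ 478$, and let $C_3$ be the simplicial complex obtained by gluing together three copies of $X$ along $A$. Then $C_3$ is constructible and not partitionable. In particular, not every constructible simplicial complex is partitionable.
   Context: The notation $v_1\cdots v_k$ abbreviates the set $\{v_1,\dots,v_k\}$. A simplicial complex is a finite collection of subsets (faces) of a finite set closed under taking subsets; facets are maximal faces, and the complex with given facets consists of all subsets of those facets. $\dim\sigma=|\sigma|-1$ and $\dim\Delta$ is the maximum dimension of a face. The subcomplex $A$ is the induced subcomplex of $X$ on $\{0,2,3,4,6,7,8\}$. Gluing: take the stated number of copies of $X$ on disjoint vertex sets and, for each vertex $v$ of $A$, identify all copies of $v$ to a single vertex. Since $A$ is induced, the result is a simplicial complex whose faces are the images of the faces of the copies of $X$, and any two copies of $X$ intersect exactly in $A$. Constructibility (recursive definition): a $d$-dimensional simplicial complex $\Delta$ is constructible if it is a simplex, or if it can be written as $\Delta=\Delta_1\cup\Delta_2$, where $\Delta_1$, $\Delta_2$ and $\Delta_1\cap\Delta_2$ are constructible of dimensions $d$, $d$ and $d-1$ respectively. A pure simplicial complex $\Delta$ (all facets of the same dimension) with facets $F_1,\dots,F_n$ is partitionable if there exist faces $R_i\subseteq F_i$ such that $\Delta=\bigsqcup_{i=1}^n[R_i,F_i]$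 (disjoint union), where $[R_i,F_i]=\{\sigma\in\Delta : R_i\subseteq\sigma\subseteq F_i\}$. *)

theory Defs
  imports "HOL-Library.Disjoint_Sets"
begin

section \<open>Simplicial complexes\<close>

text \<open>A complex is the set of all its faces; every nonempty complex has the empty face,
  of dimension \<open>-1\<close>.\<close>

definition simplicial_complex :: "'a set set \<Rightarrow> bool" where
  "simplicial_complex D \<longleftrightarrow> finite (\<Union>D) \<and> (\<forall>\<sigma>\<in>D. \<forall>\<tau>. \<tau> \<subseteq> \<sigma> \<longrightarrow> \<tau> \<in> D)"

definition face_dim :: "'a set \<Rightarrow> int" where
  "face_dim \<sigma> = int (card \<sigma>) - 1"

text \<open>Unspecified for the void complex \<open>{}\<close>, to which it is never applied below.\<close>

definition complex_dim :: "'a set set \<Rightarrow> int" where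
  "complex_dim D = Max (face_dim ` D)"

definition facets :: "'a set set \<Rightarrow> 'a set set" where
  "facets D = {F \<in> D. \<forall>G\<in>D. F \<subseteq> G \<longrightarrow> G = F}"

definition pure :: "'a set set \<Rightarrow> bool" where
  "pure D \<longleftrightarrow> (\<forall>F\<in>facets D. \<forall>G\<in>facets D. face_dim F = face_dim G)"

definition complex_of_facets :: "'a set set \<Rightarrow> 'a set set" where
  "complex_of_facets Fs = {\<sigma>. \<exists>F\<in>Fs. \<sigma> \<subseteq> F}"

definition induced_subcomplex :: "'a set set \<Rightarrow> 'a set \<Rightarrow> 'a set set" where
  "induced_subcomplex D W = {\<sigma> \<in> D. \<sigma> \<subseteq> W}"

text \<open>The simplices include \<open>Pow {} = {{}}\<close>, of dimension \<open>-1\<close>, so that two distinct points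
  form a constructible complex of dimension 0.\<close>

inductive constructible :: "'a set set \<Rightarrow> bool" where
  simplex: "finite F \<Longrightarrow> constructible (Pow F)"
| union: "\<lbrakk>constructible D1; constructible D2; constructible (D1 \<inter> D2);
    complex_dim D1 = complex_dim (D1 \<union> D2); complex_dim D2 = complex_dim (D1 \<union> D2);
    complex_dim (D1 \<inter> D2) = complex_dim (D1 \<union> D2) - 1\<rbrakk>
    \<Longrightarrow> constructible (D1 \<union> D2)"

definition face_interval :: "'a set set \<Rightarrow> 'a set \<Rightarrow> 'a set \<Rightarrow> 'a set set" where
  "face_interval D R F = {\<sigma> \<in> D. R \<subseteq> \<sigma> \<and> \<sigma> \<subseteq> F}"

definition partitionable :: "'a set set \<Rightarrow> bool" where
  "partitionable D \<longleftrightarrow> simplicial_complex D \<and> pure D \<and>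
    (\<exists>R. (\<forall>F\<in>facets D. R F \<in> D \<and> R F \<subseteq> F) \<and>
         disjoint_family_on (\<lambda>F. face_interval D (R F) F) (facets D) \<and>
         D = (\<Union>F\<in>facets D. face_interval D (R F) F))"

lemma simplicial_complex_finite: "simplicial_complex D \<Longrightarrow> finite D"
  unfolding simplicial_complex_def by (meson finite_UnionD)

lemma constructible_imp_simplicial_complex: "constructible D \<Longrightarrow> simplicial_complex D"
proof (induction rule: constructible.induct)
  case (simplex F)
  then show ?case by (simp add: simplicial_complex_def) (blast intro: order_trans)
next
  case (union D1 D2)
  then have "simplicial_complex D1" "simplicial_complex D2" by simp_all
  then show ?case unfolding simplicial_complex_def Union_Un_distrib by blast
qed

section \<open>Gluing copies along a subcomplex\<close>

text \<open>The vertex \<open>v\<close> of the \<open>i\<close>-th of the disjoint copies is \<open>(i, v)\<close>. If \<open>v\<close> lies in the vertex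
  set \<open>W\<close> of the subcomplex, then all \<open>(i, v)\<close> are identified, and \<open>(0, v)\<close> represents
  the resulting vertex.\<close>

definition glue_vertex :: "'a set \<Rightarrow> nat \<Rightarrow> 'a \<Rightarrow> nat \<times> 'a" where
  "glue_vertex W i v = (if v \<in> W then (0, v) else (i, v))"

definition glue :: "nat \<Rightarrow> 'a set set \<Rightarrow> 'a set set \<Rightarrow> (nat \<times> 'a) set set" where
  "glue n X A = (\<Union>i<n. (\<lambda>\<sigma>. glue_vertex (\<Union>A) i ` \<sigma>) ` X)"

section \<open>The complexes\<close>

definition complex_X :: "nat set set" where
  "complex_X = complex_of_facets
    {{1,2,4,9}, {1,2,6,9}, {1,5,6,9}, {1,5,8,9}, {1,4,8,9}, {1,4,5,8}, {1,4,5,7},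
     {4,5,7,8}, {1,2,5,6}, {0,1,2,5}, {0,2,5,6}, {0,1,2,3}, {1,2,3,4}, {1,3,4,7}}"

definition complex_A :: "nat set set" where
  "complex_A = complex_of_facets {{0,2,6}, {0,2,3}, {2,3,4}, {3,4,7}, {4,7,8}}"

definition complex_C3 :: "(nat \<times> nat) set set" where
  "complex_C3 = glue 3 complex_X complex_A"

lemma complex_A_induced: "complex_A = induced_subcomplex complex_X {0,2,3,4,6,7,8}"
proof -
  have *: "induced_subcomplex (complex_of_facets Fs) W = complex_of_facets ((\<lambda>F. F \<inter> W) ` Fs)"
    for W :: "nat set" and Fs
    by (rule set_eqI) (simp add: induced_subcomplex_def complex_of_facets_def)
  have mono: "complex_of_facets Fs \<subseteq> complex_of_facets Gs" if cover: "\<forall>F\<in>Fs. \<exists>G\<in>Gs. F \<subseteq> G"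
    for Fs Gs :: "nat set set"
  proof
    fix \<sigma>
    assume "\<sigma> \<in> complex_of_facets Fs"
    then obtain F where F: "F \<in> Fs" "\<sigma> \<subseteq> F"
      unfolding complex_of_facets_def by (elim CollectE bexE)
    obtain G where "G \<in> Gs" "F \<subseteq> G"
      using bspec[OF cover F(1)] by (elim bexE)
    then show "\<sigma> \<in> complex_of_facets Gs"
      unfolding complex_of_facets_def using F(2) by (intro CollectI bexI[of _ G]) simp_all
  qed
  show ?thesis
    unfolding complex_X_def complex_A_def * image_insert image_empty
    by (rule antisym; rule mono) simp_all
qed

lemma glue_vertex_inj: "inj (glue_vertex W i)"
  by (rule injI) (auto simp: glue_vertex_def split: if_splits)

lemma simplicial_complex_of_facets:
  assumes "finite Fs" "\<forall>F\<in>Fs. finite F"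
  shows "simplicial_complex (complex_of_facets Fs)"
proof -
  have "\<Union>(complex_of_facets Fs) = \<Union>Fs"
    unfolding complex_of_facets_def by blast
  moreover have "finite (\<Union>Fs)"
    using assms by simp
  moreover have "\<tau> \<in> complex_of_facets Fs" if "\<sigma> \<in> complex_of_facets Fs" "\<tau> \<subseteq> \<sigma>" for \<sigma> \<tau>
    using that unfolding complex_of_facets_def by (simp add: Bex_def) (meson order_trans)
  ultimately show ?thesis
    unfolding simplicial_complex_def by simp
qed

lemma simplicial_complex_glue:
  assumes "simplicial_complex X"
  shows "simplicial_complex (glue n X A)"
  unfolding simplicial_complex_def
proof (intro conjI ballI allI impI)
  have "finite \<sigma>" if "\<sigma> \<in> X" for \<sigma>
    using assms that by (meson Union_upper finite_subset simplicial_complex_def)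
  then show "finite (\<Union>(glue n X A))"
    unfolding glue_def using simplicial_complex_finite[OF assms]
    by (intro finite_Union finite_UN_I finite_imageI) (simp_all, elim bexE imageE, simp)
next
  fix \<sigma> \<tau>
  assume "\<sigma> \<in> glue n X A" and "\<tau> \<subseteq> \<sigma>"
  then obtain i \<rho> where i: "i < n" "\<rho> \<in> X" "\<tau> \<subseteq> glue_vertex (\<Union>A) i ` \<rho>"
    unfolding glue_def by (elim UN_E imageE) simp
  then obtain \<rho>' where \<rho>': "\<rho>' \<subseteq> \<rho>" "\<tau> = glue_vertex (\<Union>A) i ` \<rho>'"
    by (meson subset_imageE)
  then have "\<rho>' \<in> X"
    using assms i(2) by (simp add: simplicial_complex_def)
  then show "\<tau> \<in> glue n X A"
    unfolding glue_def using i(1) \<rho>'(2) by (intro UN_I[of i] image_eqI[of _ _ \<rho>']) simp_all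
qed

lemma simplicial_complex_C3: "simplicial_complex complex_C3"
  unfolding complex_C3_def complex_X_def
  by (intro simplicial_complex_glue simplicial_complex_of_facets) simp_all

lemma facet_C3_card:
  assumes "F \<in> facets complex_C3"
  shows "card F = 4"
proof -
  obtain i \<sigma> where i: "i < 3" "\<sigma> \<in> complex_X" "F = glue_vertex (\<Union>complex_A) i ` \<sigma>"
    using assms unfolding facets_def complex_C3_def glue_def by blast
  obtain Fs where Fs: "complex_X = complex_of_facets Fs" "\<forall>G\<in>Fs. card G = 4"
    by (rule that[OF complex_X_def]) simp
  have "\<exists>G\<in>Fs. \<sigma> \<subseteq> G"
    using i(2) unfolding Fs(1) complex_of_facets_def by simp
  then obtain G where G: "G \<in> Fs" "\<sigma> \<subseteq> G" ..
  have "card G = 4"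
    using Fs(2) G(1) by simp
  have "G \<in> complex_X"
    unfolding Fs(1) complex_of_facets_def using G(1) by (simp add: Bex_def) (rule exI[of _ G], simp)
  have "glue_vertex (\<Union>complex_A) i ` G \<in> complex_C3"
    unfolding complex_C3_def glue_def using i(1) \<open>G \<in> complex_X\<close> by (intro UN_I[of i] imageI) simp_all
  then have "glue_vertex (\<Union>complex_A) i ` G = F"
    using assms unfolding facets_def i(3) by (simp add: image_mono[OF G(2)])
  then show ?thesis
    using \<open>card G = 4\<close> card_image[OF inj_on_subset[OF glue_vertex_inj subset_UNIV]] by metis
qed

lemma pure_C3: "pure complex_C3"
  by (simp add: pure_def face_dim_def facet_C3_card)

end

theory Submission
  imports Defs
begin

text \<open>Constructibility: \<open>X\<close> is a shellable 3-ball and \<open>A\<close> a shellable 2-ball, and each new copy of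
  \<open>X\<close> meets the previous ones exactly in \<open>A\<close>.

  Non-partitionability: in a partitioning of \<open>C\<^sub>3\<close> the edges \<open>26\<close> and \<open>48\<close> of \<open>A\<close> lie in two intervals,
  whose facets belong to at most two of the three copies. In the remaining copy let \<open>r F\<close> be the
  bottom of the interval with top \<open>F\<close>; every face of \<open>X\<close> outside \<open>A\<close> must be covered within that
  copy, but \<open>26\<close> and \<open>48\<close> are not. The triangle \<open>269\<close> is only in \<open>1269\<close>, so \<open>9 \<in> r 1269\<close>; hence \<open>126\<close> is
  covered from \<open>1256\<close>, and \<open>1 \<in> r 1256\<close>. So \<open>256\<close> is covered from \<open>0256\<close>, which then also covers \<open>56\<close>, as
  \<open>056\<close> is only in \<open>0256\<close>. Consequently \<open>9 \<in> r 1569\<close> (look at \<open>569\<close>) and \<open>156\<close> is covered from \<open>1256\<close>, so that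
  \<open>r 1256 \<subseteq> 16\<close>. As \<open>r 0125 \<subseteq> 015\<close>, whichever of \<open>1256\<close> and \<open>0125\<close> covers \<open>125\<close> also covers the edge
  \<open>15\<close>. The automorphism \<open>(0 7)(2 4)(6 8)\<close> of \<open>X\<close> shows that \<open>1458\<close> or \<open>1457\<close> covers \<open>15\<close> as well.\<close>

section \<open>Shellings\<close>

lemma complex_dim_eqI:
  assumes "finite D" "\<sigma> \<in> D" "int (card \<sigma>) - 1 = d" "\<And>\<tau>. \<tau> \<in> D \<Longrightarrow> card \<tau> \<le> card \<sigma>"
  shows "complex_dim D = d"
  unfolding complex_dim_def
proof (rule Max_eqI)
  show "y \<le> d" if "y \<in> face_dim ` D" for y
    using that assms(3,4) unfolding face_dim_def by fastforce
qed (use assms(1-3) in \<open>auto simp: face_dim_def\<close>)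

lemma complex_dim_of_facets:
  assumes "finite Fs" "Fs \<noteq> {}" "\<forall>F\<in>Fs. finite F \<and> card F = k"
  shows "complex_dim (complex_of_facets Fs) = int k - 1"
proof -
  obtain F where F: "F \<in> Fs"
    using assms(2) by blast
  show ?thesis
  proof (rule complex_dim_eqI[of _ F])
    show "finite (complex_of_facets Fs)"
      using assms by (intro simplicial_complex_finite[OF simplicial_complex_of_facets]) auto
    show "F \<in> complex_of_facets Fs"
      using F by (auto simp: complex_of_facets_def)
    show "int (card F) - 1 = int k - 1"
      using F assms(3) by simp
    show "card \<tau> \<le> card F" if "\<tau> \<in> complex_of_facets Fs" for \<tau>
    proof -
      obtain G where "G \<in> Fs" "\<tau> \<subseteq> G"
        using \<open>\<tau> \<in> complex_of_facets Fs\<close> unfolding complex_of_facets_def by blast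
      then show ?thesis
        using card_mono[of G \<tau>] F assms(3) by simp
    qed
  qed
qed

text \<open>Generators of equal finite size contain one another only if they are equal, so each of
  them is maximal.\<close>

lemma facets_complex_of_facets:
  assumes "\<forall>F\<in>Fs. finite F \<and> card F = k"
  shows "facets (complex_of_facets Fs) = Fs"
proof
  show "facets (complex_of_facets Fs) \<subseteq> Fs"
    unfolding facets_def complex_of_facets_def by fastforce
  show "Fs \<subseteq> facets (complex_of_facets Fs)"
  proof
    fix F assume F: "F \<in> Fs"
    have "G = F" if "G \<subseteq> H" "H \<in> Fs" "F \<subseteq> G" for G H
    proof -
      have "finite H" "card F = card H"
        using assms F \<open>H \<in> Fs\<close> by simp_all
      then have "F = H"
        using that by (intro card_subset_eq) auto
      then show ?thesis
        using that by blast
    qed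
    then show "F \<in> facets (complex_of_facets Fs)"
      using F unfolding facets_def complex_of_facets_def by blast
  qed
qed

text \<open>Such faces are proper subsets of \<open>F\<close>, and removing a single vertex of
  \<open>E\<close> from \<open>F\<close> already gives one of them.\<close>

lemma complex_dim_not_superset:
  assumes "finite F" "E \<subseteq> F" "E \<noteq> {}"
  shows "complex_dim {\<sigma>. \<sigma> \<subseteq> F \<and> \<not> E \<subseteq> \<sigma>} = int (card F) - 2"
proof -
  obtain e where e: "e \<in> E"
    using assms(3) by blast
  then have card: "Suc (card (F - {e})) = card F"
    using assms by (metis card_Suc_Diff1 subsetD)
  show ?thesis
  proof (rule complex_dim_eqI[of _ "F - {e}"])
    show "card \<tau> \<le> card (F - {e})" if "\<tau> \<in> {\<sigma>. \<sigma> \<subseteq> F \<and> \<not> E \<subseteq> \<sigma>}" for \<tau>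
    proof -
      have "\<tau> \<subset> F"
        using that assms(2) by auto
      then have "card \<tau> < card F"
        by (rule psubset_card_mono[OF assms(1)])
      then show ?thesis
        using card by linarith
    qed
    show "finite {\<sigma>. \<sigma> \<subseteq> F \<and> \<not> E \<subseteq> \<sigma>}"
      using assms(1) by simp
    show "F - {e} \<in> {\<sigma>. \<sigma> \<subseteq> F \<and> \<not> E \<subseteq> \<sigma>}"
      using e by blast
    show "int (card (F - {e})) - 1 = int (card F) - 2"
      using card by linarith
  qed
qed

text \<open>This is the part of the boundary of \<open>F\<close> along which a facet with
  restriction \<open>E\<close> is attached in a shelling. Induction on \<open>E\<close>: a further
  vertex \<open>e\<close> contributes the simplex on \<open>F - {e}\<close>, which meets the rest in
  the complex of the same kind for \<open>E\<close> inside \<open>F - {e}\<close>; hence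
  \<open>F\<close> is kept arbitrary.\<close>

lemma constructible_not_superset:
  assumes "finite F" "E \<subseteq> F" "E \<noteq> {}"
  shows "constructible {\<sigma>. \<sigma> \<subseteq> F \<and> \<not> E \<subseteq> \<sigma>}"
proof -
  have "finite E"
    using assms finite_subset by blast
  then show ?thesis
    using assms(3,1,2)
  proof (induction E arbitrary: F rule: finite_ne_induct)
    case (singleton e)
    have "{\<sigma>. \<sigma> \<subseteq> F \<and> \<not> {e} \<subseteq> \<sigma>} = Pow (F - {e})"
      by auto
    then show ?case
      using singleton by (metis constructible.simplex finite_Diff)
  next
    case (insert e E)
    let ?D1 = "{\<sigma>. \<sigma> \<subseteq> F \<and> \<not> E \<subseteq> \<sigma>}" and ?D2 = "{\<sigma>. \<sigma> \<subseteq> F \<and> \<not> {e} \<subseteq> \<sigma>}"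
    have un: "{\<sigma>. \<sigma> \<subseteq> F \<and> \<not> insert e E \<subseteq> \<sigma>} = ?D1 \<union> ?D2"
      by auto
    have int: "?D1 \<inter> ?D2 = {\<sigma>. \<sigma> \<subseteq> F - {e} \<and> \<not> E \<subseteq> \<sigma>}"
      using insert.hyps(3) by blast
    have D2: "?D2 = Pow (F - {e})"
      by auto
    have E: "E \<subseteq> F" "E \<subseteq> F - {e}" "e \<in> F"
      using insert.prems(2) insert.hyps(3) by blast+
    have card: "int (card (F - {e})) = int (card F) - 1"
      using card_Suc_Diff1[OF insert.prems(1) E(3)] by linarith
    have dim: "complex_dim (?D1 \<union> ?D2) = int (card F) - 2"
      unfolding un[symmetric] using insert.prems by (intro complex_dim_not_superset) simp_all
    show ?case
      unfolding un
    proof (rule constructible.union)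
      show "constructible ?D1"
        using insert.prems(1) E(1) by (rule insert.IH)
      show "constructible ?D2"
        unfolding D2 using insert.prems(1) by (intro constructible.simplex finite_Diff)
      show "constructible (?D1 \<inter> ?D2)"
        unfolding int using finite_Diff[OF insert.prems(1)] E(2) by (rule insert.IH)
      show "complex_dim ?D1 = complex_dim (?D1 \<union> ?D2)"
        unfolding dim using insert.prems(1) E(1) insert.hyps(2) by (rule complex_dim_not_superset)
      show "complex_dim ?D2 = complex_dim (?D1 \<union> ?D2)"
        unfolding dim using insert.prems(1) E(3) by (intro complex_dim_not_superset) simp_all
      show "complex_dim (?D1 \<inter> ?D2) = complex_dim (?D1 \<union> ?D2) - 1"
        unfolding dim int complex_dim_not_superset[OF finite_Diff[OF insert.prems(1)] E(2) insert.hyps(2)]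
        using card by linarith
    qed
  qed
qed

text \<open>The conditions on \<open>R\<close> make the old faces inside \<open>F\<close> exactly
  those not containing \<open>R\<close>: a face missing some \<open>v\<close> in \<open>R\<close>
  lies in \<open>F - {v}\<close>, hence in an old facet, while no old facet contains
  \<open>R\<close>.\<close>

lemma constructible_add_facet:
  assumes con: "constructible (complex_of_facets Gs)"
    and Gs: "finite Gs" "Gs \<noteq> {}" "\<forall>G\<in>insert F Gs. finite G \<and> card G = k"
    and R: "R \<subseteq> F" "R \<noteq> {}" "\<forall>G\<in>Gs. \<not> R \<subseteq> G" "\<forall>v\<in>R. \<exists>G\<in>Gs. F - {v} \<subseteq> G"
  shows "constructible (complex_of_facets (insert F Gs))"
proof -
  have un: "complex_of_facets (insert F Gs) = complex_of_facets Gs \<union> Pow F"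
    unfolding complex_of_facets_def by auto
  have int: "complex_of_facets Gs \<inter> Pow F = {\<sigma>. \<sigma> \<subseteq> F \<and> \<not> R \<subseteq> \<sigma>}"
  proof (intro equalityI subsetI)
    fix \<sigma> assume "\<sigma> \<in> {\<sigma>. \<sigma> \<subseteq> F \<and> \<not> R \<subseteq> \<sigma>}"
    then obtain v where v: "v \<in> R" "\<sigma> \<subseteq> F - {v}" "\<sigma> \<subseteq> F"
      by blast
    then obtain G where "G \<in> Gs" "F - {v} \<subseteq> G"
      using R(4) by blast
    then show "\<sigma> \<in> complex_of_facets Gs \<inter> Pow F"
      using v unfolding complex_of_facets_def by blast
  qed (use R(3) in \<open>auto simp: complex_of_facets_def\<close>)
  have F: "finite F" "card F = k"
    using Gs by auto
  have PowF: "Pow F = complex_of_facets {F}"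
    unfolding complex_of_facets_def by auto
  have dim: "complex_dim (complex_of_facets Gs \<union> Pow F) = int k - 1"
    unfolding un[symmetric] using Gs by (intro complex_dim_of_facets) auto
  show ?thesis
    unfolding un
  proof (rule constructible.union[OF con])
    show "constructible (Pow F)"
      using F by (intro constructible.simplex)
    show "constructible (complex_of_facets Gs \<inter> Pow F)"
      unfolding int using F R by (intro constructible_not_superset)
    show "complex_dim (complex_of_facets Gs) = complex_dim (complex_of_facets Gs \<union> Pow F)"
      unfolding dim using Gs by (intro complex_dim_of_facets) auto
    show "complex_dim (Pow F) = complex_dim (complex_of_facets Gs \<union> Pow F)"
      unfolding dim unfolding PowF using F by (intro complex_dim_of_facets) auto
    show "complex_dim (complex_of_facets Gs \<inter> Pow F)
        = complex_dim (complex_of_facets Gs \<union> Pow F) - 1"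
      unfolding dim int complex_dim_not_superset[OF F(1) R(1,2)] F(2) by simp
  qed
qed

text \<open>Each facet is paired with its restriction, the unique minimal new face when the facet is
  added. The list runs backwards: its head is the facet added last.\<close>

fun shelling :: "('a set \<times> 'a set) list \<Rightarrow> bool" where
  "shelling [] \<longleftrightarrow> False"
| "shelling [(F, R)] \<longleftrightarrow> True"
| "shelling ((F, R) # p # ps) \<longleftrightarrow> shelling (p # ps) \<and> R \<subseteq> F \<and> R \<noteq> {} \<and>
     (\<forall>G\<in>fst ` set (p # ps). \<not> R \<subseteq> G) \<and> (\<forall>v\<in>R. \<exists>G\<in>fst ` set (p # ps). F - {v} \<subseteq> G)"

lemma shelling_constructible:
  assumes "shelling ps" "\<forall>F\<in>fst ` set ps. finite F \<and> card F = k"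
  shows "constructible (complex_of_facets (fst ` set ps))"
  using assms
proof (induction ps rule: shelling.induct)
  case (2 F R)
  have "complex_of_facets {F} = Pow F"
    unfolding complex_of_facets_def by auto
  then show ?case
    using 2 by (auto intro: constructible.simplex)
next
  case (3 F R p ps)
  have eq: "fst ` set ((F, R) # p # ps) = insert F (fst ` set (p # ps))"
    by simp
  show ?case
    unfolding eq
    by (rule constructible_add_facet[where R = R and k = k]) (use 3 in auto)
qed simp

section \<open>Explicit shellings of \<open>complex_X\<close> and \<open>complex_A\<close>\<close>

lemma constructible_X: "constructible complex_X"
proof -
  \<comment> \<open>The order of the facets in the definition is already a shelling order. Each
    restriction consists of the vertices whose opposite triangle lies in an earlier facet.\<close>
  let ?ps = "rev [({1,2,4,9::nat}, {}), ({1,2,6,9}, {6}), ({1,5,6,9}, {5}), ({1,5,8,9}, {8}),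
    ({1,4,8,9}, {4,8}), ({1,4,5,8}, {4,5}), ({1,4,5,7}, {7}), ({4,5,7,8}, {7,8}),
    ({1,2,5,6}, {2,5}), ({0,1,2,5}, {0}), ({0,2,5,6}, {0,6}), ({0,1,2,3}, {3}),
    ({1,2,3,4}, {3,4}), ({1,3,4,7}, {3,7::nat})]"
  have "constructible (complex_of_facets (fst ` set ?ps))"
    by (rule shelling_constructible[where k = 4]) (simp_all add: insert_Diff_if)
  moreover have "complex_of_facets (fst ` set ?ps) = complex_X"
    unfolding complex_X_def set_rev by simp
  ultimately show ?thesis
    by simp
qed

lemma constructible_A: "constructible complex_A"
proof -
  let ?ps = "rev [({0,2,6::nat}, {}), ({0,2,3}, {3}), ({2,3,4}, {4}), ({3,4,7}, {7}), ({4,7,8}, {8::nat})]"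
  have "constructible (complex_of_facets (fst ` set ?ps))"
    by (rule shelling_constructible[where k = 3]) (simp_all add: insert_Diff_if)
  moreover have "complex_of_facets (fst ` set ?ps) = complex_A"
    unfolding complex_A_def set_rev by simp
  ultimately show ?thesis
    by simp
qed

section \<open>Gluing constructible complexes\<close>

lemma complex_dim_image:
  assumes "inj f"
  shows "complex_dim ((`) f ` D) = complex_dim D"
proof -
  have "face_dim (f ` \<sigma>) = face_dim \<sigma>" for \<sigma>
    using assms by (simp add: face_dim_def card_image inj_on_subset[OF _ subset_UNIV])
  then show ?thesis
    by (simp add: complex_dim_def image_image)
qed

text \<open>An injective map preserves cardinalities and commutes with intersections, so it carries
  every decomposition along.\<close>

lemma constructible_image:
  assumes "inj f" "constructible D"
  shows "constructible ((`) f ` D)"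
  using assms(2)
proof (induction rule: constructible.induct)
  case (simplex F)
  then show ?case
    by (metis constructible.simplex finite_imageI image_Pow_surj)
next
  case (union D1 D2)
  have inj: "inj ((`) f)"
    using assms(1) by (simp add: inj_image_eq_iff inj_def)
  have int: "(`) f ` D1 \<inter> (`) f ` D2 = (`) f ` (D1 \<inter> D2)"
    using image_Int[OF inj] by simp
  show ?case
    unfolding image_Un
    by (rule constructible.union, unfold int image_Un[symmetric] complex_dim_image[OF assms(1)])
       (use union in auto)
qed

lemma glue_vertex_eq_iff:
  assumes "v \<notin> W"
  shows "glue_vertex W i v = glue_vertex W j u \<longleftrightarrow> i = j \<and> v = u"
  using assms by (auto simp: glue_vertex_def)

lemma glue_vertex_image_subset:
  assumes "\<sigma> \<subseteq> W"
  shows "glue_vertex W i ` \<sigma> = glue_vertex W j ` \<sigma>"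
  using assms by (intro image_cong) (auto simp: glue_vertex_def)

text \<open>A vertex outside \<open>W\<close> is identified with no other vertex, so its image
  records the copy it comes from.\<close>

lemma glue_vertex_image_copy:
  assumes "glue_vertex W i ` \<sigma> \<subseteq> glue_vertex W j ` \<rho>" "\<not> \<sigma> \<subseteq> W"
  shows "i = j"
proof -
  obtain v where "v \<in> \<sigma>" "v \<notin> W"
    using assms(2) by blast
  then show ?thesis
    using assms(1) glue_vertex_eq_iff[of v W i j] by blast
qed

lemma complex_dim_glue:
  assumes "n > 0"
  shows "complex_dim (glue n X A) = complex_dim X"
proof -
  have "face_dim (glue_vertex W i ` \<sigma>) = face_dim \<sigma>" for W i and \<sigma> :: "'a set"
    by (simp add: face_dim_def card_image inj_on_subset[OF glue_vertex_inj subset_UNIV])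
  then have "face_dim ` glue n X A = face_dim ` X"
    using assms unfolding glue_def image_UN image_image by auto
  then show ?thesis
    by (simp add: complex_dim_def)
qed

lemma glue_Suc: "glue (Suc n) X A = glue n X A \<union> (`) (glue_vertex (\<Union>A) n) ` X"
  by (auto simp: glue_def lessThan_Suc)

text \<open>A common face of copy \<open>n\<close> and an earlier copy has no vertex outside
  \<open>A\<close>, so it belongs to \<open>A\<close> because \<open>A\<close> is induced. On
  \<open>A\<close> all gluing maps agree, so copy 0 can represent it.\<close>

lemma glue_Int_copy:
  assumes "A = induced_subcomplex X (\<Union>A)" "n > 0"
  shows "glue n X A \<inter> (`) (glue_vertex (\<Union>A) n) ` X = (`) (glue_vertex (\<Union>A) 0) ` A"
proof (intro equalityI subsetI)
  fix \<tau> assume "\<tau> \<in> glue n X A \<inter> (`) (glue_vertex (\<Union>A) n) ` X"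
  then obtain i \<sigma> \<rho> where *: "i < n" "\<sigma> \<in> X" "\<rho> \<in> X" "\<tau> = glue_vertex (\<Union>A) i ` \<sigma>"
      "\<tau> = glue_vertex (\<Union>A) n ` \<rho>"
    unfolding glue_def by auto
  then have "\<sigma> \<subseteq> \<Union>A"
    using glue_vertex_image_copy[of "\<Union>A" i \<sigma> n \<rho>] by auto
  then have "\<sigma> \<in> A" "\<tau> = glue_vertex (\<Union>A) 0 ` \<sigma>"
    using * assms(1) glue_vertex_image_subset unfolding induced_subcomplex_def by blast+
  then show "\<tau> \<in> (`) (glue_vertex (\<Union>A) 0) ` A"
    by blast
next
  fix \<tau> assume "\<tau> \<in> (`) (glue_vertex (\<Union>A) 0) ` A"
  then obtain \<sigma> where \<sigma>: "\<sigma> \<in> A" "\<tau> = glue_vertex (\<Union>A) 0 ` \<sigma>"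
    by blast
  then have "\<sigma> \<in> X" "\<tau> = glue_vertex (\<Union>A) n ` \<sigma>"
    using assms(1) glue_vertex_image_subset unfolding induced_subcomplex_def by blast+
  then show "\<tau> \<in> glue n X A \<inter> (`) (glue_vertex (\<Union>A) n) ` X"
    using \<sigma> assms(2) unfolding glue_def by blast
qed

lemma constructible_glue:
  assumes X: "constructible X" and A: "constructible A" "A = induced_subcomplex X (\<Union>A)"
    and dim: "complex_dim A = complex_dim X - 1" and "n > 0"
  shows "constructible (glue n X A)"
  using \<open>n > 0\<close>
proof (induction n rule: nat_induct_non_zero)
  case 1
  have "glue 1 X A = (`) (glue_vertex (\<Union>A) 0) ` X"
    by (auto simp: glue_def lessThan_Suc)
  then show ?case
    using constructible_image[OF glue_vertex_inj X] by simp
next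
  case (Suc n)
  have dim_Suc: "complex_dim (glue n X A \<union> (`) (glue_vertex (\<Union>A) n) ` X) = complex_dim X"
    unfolding glue_Suc[symmetric] by (rule complex_dim_glue) simp
  show ?case
    unfolding glue_Suc
    by (rule constructible.union[OF Suc.IH],
        unfold dim_Suc glue_Int_copy[OF A(2) Suc.hyps] complex_dim_image[OF glue_vertex_inj]
          complex_dim_glue[OF Suc.hyps])
       (simp_all add: constructible_image[OF glue_vertex_inj] X A(1) dim)
qed

lemma Union_complex_A: "\<Union>complex_A = {0,2,3,4,6,7,8}"
proof -
  have "\<Union>(complex_of_facets Fs) = \<Union>Fs" for Fs :: "nat set set"
    unfolding complex_of_facets_def by blast
  then show ?thesis
    unfolding complex_A_def by auto
qed

lemma constructible_C3: "constructible complex_C3"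
  unfolding complex_C3_def
proof (rule constructible_glue[OF constructible_X constructible_A])
  show "complex_A = induced_subcomplex complex_X (\<Union>complex_A)"
    using complex_A_induced by (simp only: Union_complex_A)
  have "complex_dim complex_A = int 3 - 1"
    unfolding complex_A_def by (rule complex_dim_of_facets) simp_all
  moreover have "complex_dim complex_X = int 4 - 1"
    unfolding complex_X_def by (rule complex_dim_of_facets) simp_all
  ultimately show "complex_dim complex_A = complex_dim complex_X - 1"
    by simp
qed simp

section \<open>Partitionings of glued complexes\<close>

text \<open>A facet of \<open>X\<close> has a vertex outside \<open>A\<close>, so any face above its
  image lies in the same copy, where the gluing map is injective.\<close>

lemma facets_glue:
  assumes "\<forall>F\<in>facets X. \<not> F \<subseteq> \<Union>A"
  shows "facets (glue n X A) = (\<Union>i<n. (`) (glue_vertex (\<Union>A) i) ` facets X)"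
proof (intro equalityI subsetI)
  fix G assume G: "G \<in> facets (glue n X A)"
  then obtain i \<sigma> where \<sigma>: "i < n" "\<sigma> \<in> X" "G = glue_vertex (\<Union>A) i ` \<sigma>"
    unfolding facets_def glue_def by blast
  have "\<tau> = \<sigma>" if "\<tau> \<in> X" "\<sigma> \<subseteq> \<tau>" for \<tau>
  proof -
    have "glue_vertex (\<Union>A) i ` \<tau> \<in> glue n X A"
      unfolding glue_def using \<sigma>(1) that(1) by blast
    then have "glue_vertex (\<Union>A) i ` \<tau> = glue_vertex (\<Union>A) i ` \<sigma>"
      using G \<sigma>(3) image_mono[OF that(2), of "glue_vertex (\<Union>A) i"] unfolding facets_def by simp
    then show ?thesis
      by (simp add: inj_image_eq_iff[OF glue_vertex_inj])
  qed
  then have "\<sigma> \<in> facets X"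
    unfolding facets_def using \<sigma>(2) by blast
  then show "G \<in> (\<Union>i<n. (`) (glue_vertex (\<Union>A) i) ` facets X)"
    using \<sigma> by blast
next
  fix G assume "G \<in> (\<Union>i<n. (`) (glue_vertex (\<Union>A) i) ` facets X)"
  then obtain i F where F: "i < n" "F \<in> facets X" "G = glue_vertex (\<Union>A) i ` F"
    by blast
  have "H = G" if H: "H \<in> glue n X A" "G \<subseteq> H" for H
  proof -
    obtain j \<rho> where \<rho>: "\<rho> \<in> X" "H = glue_vertex (\<Union>A) j ` \<rho>"
      using H(1) unfolding glue_def by blast
    then have "i = j"
      using glue_vertex_image_copy[OF _ bspec[OF assms F(2)]] H(2) F(3) by blast
    then have "F \<subseteq> \<rho>"
      using H(2) F(3) \<rho>(2) by (simp add: inj_image_subset_iff[OF glue_vertex_inj])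
    then show ?thesis
      using F(2,3) \<rho> \<open>i = j\<close> unfolding facets_def by blast
  qed
  moreover have "G \<in> glue n X A"
    using F unfolding glue_def facets_def by blast
  ultimately show "G \<in> facets (glue n X A)"
    unfolding facets_def by blast
qed

text \<open>A face of \<open>A\<close> is covered from only one copy of \<open>X\<close>, so fewer than \<open>n\<close> such faces leave a copy
  from which none of them is covered.\<close>

lemma partitionable_glue_imp:
  assumes X: "simplicial_complex X" and facets: "\<forall>F\<in>facets X. \<not> F \<subseteq> \<Union>A"
    and part: "partitionable (glue n X A)"
    and T: "finite T" "card T < n" "T \<subseteq> X" "\<forall>\<tau>\<in>T. \<tau> \<subseteq> \<Union>A"
  obtains r where "\<forall>\<sigma>\<in>X. \<not> \<sigma> \<subseteq> \<Union>A \<longrightarrow> (\<exists>F\<in>facets X. r F \<subseteq> \<sigma> \<and> \<sigma> \<subseteq> F)"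
    and "\<forall>F\<in>facets X. \<forall>G\<in>facets X. \<forall>\<sigma>. r F \<subseteq> \<sigma> \<and> \<sigma> \<subseteq> F \<and> r G \<subseteq> \<sigma> \<and> \<sigma> \<subseteq> G \<longrightarrow> F = G"
    and "\<forall>F\<in>facets X. \<forall>\<tau>\<in>T. \<tau> \<subseteq> F \<longrightarrow> \<not> r F \<subseteq> \<tau>"
proof -
  define D where "D = glue n X A"
  define g where "g = glue_vertex (\<Union>A)"
  have inj: "inj (g i)" for i
    unfolding g_def by (rule glue_vertex_inj)
  have fD: "G \<in> facets D \<longleftrightarrow> (\<exists>i<n. \<exists>F\<in>facets X. G = g i ` F)" for G
    unfolding D_def g_def facets_glue[OF facets] by blast
  have inD: "g i ` \<sigma> \<in> D" if "i < n" "\<sigma> \<in> X" for i \<sigma>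
    using that unfolding D_def glue_def g_def by blast
  have copy: "i = j" if "g i ` \<sigma> \<subseteq> g j ` \<rho>" "\<not> \<sigma> \<subseteq> \<Union>A" for i j \<sigma> \<rho>
    using glue_vertex_image_copy that unfolding g_def by blast
  obtain R where R: "\<And>F. F \<in> facets D \<Longrightarrow> R F \<subseteq> F"
    and dis: "disjoint_family_on (\<lambda>F. face_interval D (R F) F) (facets D)"
    and cov: "D = (\<Union>F\<in>facets D. face_interval D (R F) F)"
    using part unfolding partitionable_def D_def[symmetric] by blast
  have unique: "F = G" if "F \<in> facets D" "G \<in> facets D" "\<sigma> \<in> D" "R F \<subseteq> \<sigma>" "\<sigma> \<subseteq> F" "R G \<subseteq> \<sigma>" "\<sigma> \<subseteq> G"
    for F G \<sigma>
    using disjoint_family_onD[OF dis that(1,2)] that(3-) unfolding face_interval_def by blast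
  \<comment> \<open>Pigeonhole: otherwise every copy \<open>i\<close> covers some \<open>t i\<close>
    in \<open>T\<close>. If \<open>t i = t j\<close>, this one face of the glued complex lies in
    intervals with tops in copies \<open>i\<close> and \<open>j\<close>, so disjointness forces
    \<open>i = j\<close>. Then \<open>t\<close> injects \<open>n\<close> copies into the smaller set
    \<open>T\<close>.\<close>
  have "\<exists>i<n. \<forall>\<tau>\<in>T. \<forall>F\<in>facets X. \<tau> \<subseteq> F \<longrightarrow> \<not> R (g i ` F) \<subseteq> g i ` \<tau>"
  proof (rule ccontr)
    assume "\<not> ?thesis"
    then have "\<forall>i. \<exists>\<tau>. i < n \<longrightarrow> \<tau> \<in> T \<and> (\<exists>F\<in>facets X. \<tau> \<subseteq> F \<and> R (g i ` F) \<subseteq> g i ` \<tau>)"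
      by meson
    from choice[OF this] obtain t where
      "\<forall>i. i < n \<longrightarrow> t i \<in> T \<and> (\<exists>F\<in>facets X. t i \<subseteq> F \<and> R (g i ` F) \<subseteq> g i ` t i)" ..
    then have t: "\<And>i. i < n \<Longrightarrow> t i \<in> T"
        "\<And>i. i < n \<Longrightarrow> \<exists>F\<in>facets X. t i \<subseteq> F \<and> R (g i ` F) \<subseteq> g i ` t i"
      by simp_all
    have "inj_on t {..<n}"
    proof (rule inj_onI)
      fix i j assume ij: "i \<in> {..<n}" "j \<in> {..<n}" "t i = t j"
      then have less: "i < n" "j < n"
        by simp_all
      obtain F where F: "F \<in> facets X" "t i \<subseteq> F" "R (g i ` F) \<subseteq> g i ` t i"
        using t(2)[OF less(1)] by blast
      obtain G where G: "G \<in> facets X" "t i \<subseteq> G" "R (g j ` G) \<subseteq> g j ` t i"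
        using t(2)[OF less(2)] unfolding ij(3)[symmetric] by blast
      have eq: "g i ` t i = g j ` t i"
        unfolding g_def by (rule glue_vertex_image_subset[OF bspec[OF T(4) t(1)[OF less(1)]]])
      have "g i ` F = g j ` G"
      proof (rule unique[of _ _ "g i ` t i"])
        show "g i ` F \<in> facets D" "g j ` G \<in> facets D"
          using fD F(1) G(1) less by blast+
        show "g i ` t i \<in> D"
          using inD[OF less(1)] T(3) t(1)[OF less(1)] by blast
        show "g i ` t i \<subseteq> g j ` G"
          using eq G(2) by blast
        show "R (g j ` G) \<subseteq> g i ` t i"
          using eq G(3) by simp
      qed (use F in \<open>simp_all add: image_mono\<close>)
      then show "i = j"
        using copy[of i F j G] bspec[OF facets F(1)] by simp
    qed
    then have "card {..<n} \<le> card T"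
      using t(1) T(1) by (intro card_inj_on_le) auto
    then show False
      using T(2) by simp
  qed
  then obtain i where i: "i < n"
    and "\<forall>\<tau>\<in>T. \<forall>F\<in>facets X. \<tau> \<subseteq> F \<longrightarrow> \<not> R (g i ` F) \<subseteq> g i ` \<tau>"
    by (elim exE conjE)
  then have avoid: "\<not> R (g i ` F) \<subseteq> g i ` \<tau>" if "\<tau> \<in> T" "F \<in> facets X" "\<tau> \<subseteq> F" for \<tau> F
    using that by simp
  \<comment> \<open>The interval bottoms of copy \<open>i\<close>, pulled back to
    \<open>X\<close>.\<close>
  define r where "r F = {v \<in> F. g i v \<in> R (g i ` F)}" for F
  have r: "r F \<subseteq> \<sigma> \<longleftrightarrow> R (g i ` F) \<subseteq> g i ` \<sigma>" if "F \<in> facets X" "\<sigma> \<subseteq> F" for F \<sigma>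
  proof -
    have "R (g i ` F) \<subseteq> g i ` F"
      using R fD i that(1) by blast
    then have "R (g i ` F) = g i ` r F"
      unfolding r_def by blast
    then show ?thesis
      by (simp add: inj_image_subset_iff[OF inj])
  qed
  show ?thesis
  proof (rule that[of r]; intro ballI allI impI)
    show "\<exists>F\<in>facets X. r F \<subseteq> \<sigma> \<and> \<sigma> \<subseteq> F" if \<sigma>: "\<sigma> \<in> X" "\<not> \<sigma> \<subseteq> \<Union>A" for \<sigma>
    proof -
      have "g i ` \<sigma> \<in> (\<Union>F\<in>facets D. face_interval D (R F) F)"
        using inD[OF i \<sigma>(1)] cov by simp
      then obtain G where G: "G \<in> facets D" "R G \<subseteq> g i ` \<sigma>" "g i ` \<sigma> \<subseteq> G"
        unfolding face_interval_def by blast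
      obtain j F where F: "F \<in> facets X" "G = g j ` F"
        using G(1) unfolding fD by blast
      \<comment> \<open>The vertex of \<open>\<sigma>\<close> outside \<open>A\<close> forces the
        covering facet into copy \<open>i\<close>.\<close>
      then have "i = j"
        using copy[of i \<sigma> j F] \<sigma>(2) G(3) by simp
      then have "\<sigma> \<subseteq> F"
        using F(2) G(3) by (simp add: inj_image_subset_iff[OF inj])
      then have "r F \<subseteq> \<sigma>"
        using r F G(2) \<open>i = j\<close> by simp
      then show ?thesis
        using F(1) \<open>\<sigma> \<subseteq> F\<close> by blast
    qed
    show "F = G" if *: "F \<in> facets X" "G \<in> facets X" "r F \<subseteq> \<sigma> \<and> \<sigma> \<subseteq> F \<and> r G \<subseteq> \<sigma> \<and> \<sigma> \<subseteq> G" for F G \<sigma>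
    proof -
      have "\<sigma> \<in> X"
        using *(1,3) X unfolding simplicial_complex_def facets_def by (metis (lifting) mem_Collect_eq)
      have "g i ` F \<in> facets D" "g i ` G \<in> facets D"
        using fD i *(1,2) by blast+
      then have "g i ` F = g i ` G"
      proof (rule unique[OF _ _ inD[OF i \<open>\<sigma> \<in> X\<close>]])
        show "R (g i ` F) \<subseteq> g i ` \<sigma>" "R (g i ` G) \<subseteq> g i ` \<sigma>"
          using r[OF *(1), of \<sigma>] r[OF *(2), of \<sigma>] *(3) by simp_all
      qed (use *(3) in \<open>simp_all add: image_mono\<close>)
      then show ?thesis
        by (simp add: inj_image_eq_iff[OF inj])
    qed
    show "\<not> r F \<subseteq> \<tau>" if "F \<in> facets X" "\<tau> \<in> T" "\<tau> \<subseteq> F" for F \<tau>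
      using avoid[OF that(2,1,3)] r[OF that(1,3)] by simp
  qed
qed

section \<open>The complex \<open>C\<^sub>3\<close> is not partitionable\<close>

text \<open>Stated with variable vertices so that it applies to both of the halves of \<open>X\<close> exchanged by
  the automorphism \<open>(0 7)(2 4)(6 8)\<close>.\<close>

lemma half_covers_edge:
  fixes x0 x1 x2 x5 x6 x9 :: 'a
  assumes "distinct [x0, x1, x2, x5, x6, x9]"
    and 269: "r1269 \<subseteq> {x2,x6,x9}" and 126: "r1269 \<subseteq> {x1,x2,x6} \<or> r1256 \<subseteq> {x1,x2,x6}"
    and 256: "r1256 \<subseteq> {x2,x5,x6} \<or> r0256 \<subseteq> {x2,x5,x6}" and 056: "r0256 \<subseteq> {x0,x5,x6}"
    and 569: "r1569 \<subseteq> {x5,x6,x9}" and 156: "r1569 \<subseteq> {x1,x5,x6} \<or> r1256 \<subseteq> {x1,x5,x6}"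
    and 015: "r0125 \<subseteq> {x0,x1,x5}" and 125: "r1256 \<subseteq> {x1,x2,x5} \<or> r0125 \<subseteq> {x1,x2,x5}"
    and 26: "\<not> r1269 \<subseteq> {x2,x6}" "\<not> r1256 \<subseteq> {x2,x6}"
    and 56: "\<not> (r0256 \<subseteq> {x5,x6} \<and> r1569 \<subseteq> {x5,x6})"
  shows "r1256 \<subseteq> {x1,x5} \<or> r0125 \<subseteq> {x1,x5}"
proof -
  \<comment> \<open>Two faces containing the same bottom also contain it in their intersection: here
    \<open>126\<close> and \<open>269\<close> would give \<open>26\<close>. The later steps likewise
    use \<open>126\<close> and \<open>256\<close> (giving \<open>26\<close>), \<open>256\<close> and
    \<open>056\<close> (giving \<open>56\<close>), \<open>156\<close> and \<open>569\<close> (giving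
    \<open>56\<close>), and \<open>126\<close> and \<open>156\<close> (giving
    \<open>16\<close>).\<close>
  have "\<not> r1269 \<subseteq> {x1,x2,x6}"
    using assms(1) 269 26(1) by auto
  then have r1256: "r1256 \<subseteq> {x1,x2,x6}"
    using 126 by blast
  then have "\<not> r1256 \<subseteq> {x2,x5,x6}"
    using assms(1) 26(2) by auto
  then have "r0256 \<subseteq> {x5,x6}"
    using assms(1) 256 056 by auto
  then have "\<not> r1569 \<subseteq> {x1,x5,x6}"
    using assms(1) 56 569 by auto
  then have "r1256 \<subseteq> {x1,x6}"
    using assms(1) 156 r1256 by auto
  \<comment> \<open>If \<open>125\<close> is covered from \<open>1256\<close>, the bottom lies in
    \<open>16\<close> and \<open>125\<close>, so in the vertex \<open>1\<close>; if from
    \<open>0125\<close>, it lies in \<open>015\<close> and \<open>125\<close>, so in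
    \<open>15\<close>.\<close>
  then show ?thesis
    using assms(1) 015 125 by auto
qed

lemma not_partitionable_C3: "\<not> partitionable complex_C3"
proof
  assume part: "partitionable complex_C3"
  define Fs :: "nat set set" where "Fs =
    {{1,2,4,9}, {1,2,6,9}, {1,5,6,9}, {1,5,8,9}, {1,4,8,9}, {1,4,5,8}, {1,4,5,7},
     {4,5,7,8}, {1,2,5,6}, {0,1,2,5}, {0,2,5,6}, {0,1,2,3}, {1,2,3,4}, {1,3,4,7}}"
  have X: "complex_X = complex_of_facets Fs"
    unfolding complex_X_def Fs_def ..
  have fX: "facets complex_X = Fs"
    unfolding X by (rule facets_complex_of_facets[where k = 4]) (simp add: Fs_def)
  have inX: "\<sigma> \<in> complex_X \<longleftrightarrow> (\<exists>F\<in>Fs. \<sigma> \<subseteq> F)" for \<sigma>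
    unfolding X complex_of_facets_def by simp
  have "\<forall>F\<in>facets complex_X. \<not> F \<subseteq> \<Union>complex_A"
    unfolding fX Union_complex_A by (simp add: Fs_def)
  moreover have "partitionable (glue 3 complex_X complex_A)"
    using part unfolding complex_C3_def .
  \<comment> \<open>Two edges against three copies: some copy covers neither.\<close>
  moreover have "finite {{2,6},{4,8::nat}}" "card {{2,6},{4,8::nat}} < 3"
    by (simp_all add: card_insert_if)
  moreover have "{{2,6},{4,8}} \<subseteq> complex_X"
    by (simp add: inX Fs_def)
  moreover have "\<forall>\<tau>\<in>{{2,6},{4,8}}. \<tau> \<subseteq> \<Union>complex_A"
    unfolding Union_complex_A by simp
  ultimately obtain r where
    cover: "\<forall>\<sigma>\<in>complex_X. \<not> \<sigma> \<subseteq> \<Union>complex_A \<longrightarrow> (\<exists>F\<in>facets complex_X. r F \<subseteq> \<sigma> \<and> \<sigma> \<subseteq> F)"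
    and unique: "\<forall>F\<in>facets complex_X. \<forall>G\<in>facets complex_X. \<forall>\<sigma>.
      r F \<subseteq> \<sigma> \<and> \<sigma> \<subseteq> F \<and> r G \<subseteq> \<sigma> \<and> \<sigma> \<subseteq> G \<longrightarrow> F = G"
    and avoid: "\<forall>F\<in>facets complex_X. \<forall>\<tau>\<in>{{2,6},{4,8}}. \<tau> \<subseteq> F \<longrightarrow> \<not> r F \<subseteq> \<tau>"
    by (rule partitionable_glue_imp[OF constructible_imp_simplicial_complex[OF constructible_X]])
  \<comment> \<open>The excluded set is the vertex set of \<open>A\<close>; every face to which this
    is applied contains 1, 5 or 9.\<close>
  have cover': "\<exists>F\<in>Fs. r F \<subseteq> \<sigma> \<and> \<sigma> \<subseteq> F" if "\<exists>F\<in>Fs. \<sigma> \<subseteq> F" "\<not> \<sigma> \<subseteq> {0,2,3,4,6,7,8}" for \<sigma>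
    using cover that unfolding fX Union_complex_A by (simp add: inX)
  have unique': "\<not> (r F \<subseteq> \<sigma> \<and> r G \<subseteq> \<sigma>)" if "F \<in> Fs" "G \<in> Fs" "\<sigma> \<subseteq> F" "\<sigma> \<subseteq> G" "F \<noteq> G" for \<sigma> F G
    using unique that unfolding fX by blast
  have "r {1,2,5,6} \<subseteq> {1,5} \<or> r {0,1,2,5} \<subseteq> {1,5}"
  proof (rule half_covers_edge[of 0 1 2 5 6 9 "r {1,2,6,9}" _ "r {0,2,5,6}" "r {1,5,6,9}"])
    show "r {1,2,6,9} \<subseteq> {2,6,9}" using cover'[of "{2,6,9}"] unfolding Fs_def by simp
    show "r {1,2,6,9} \<subseteq> {1,2,6} \<or> r {1,2,5,6} \<subseteq> {1,2,6}"
      using cover'[of "{1,2,6}"] unfolding Fs_def by simp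
    show "r {1,2,5,6} \<subseteq> {2,5,6} \<or> r {0,2,5,6} \<subseteq> {2,5,6}"
      using cover'[of "{2,5,6}"] unfolding Fs_def by simp
    show "r {0,2,5,6} \<subseteq> {0,5,6}" using cover'[of "{0,5,6}"] unfolding Fs_def by simp
    show "r {1,5,6,9} \<subseteq> {5,6,9}" using cover'[of "{5,6,9}"] unfolding Fs_def by simp
    show "r {1,5,6,9} \<subseteq> {1,5,6} \<or> r {1,2,5,6} \<subseteq> {1,5,6}"
      using cover'[of "{1,5,6}"] unfolding Fs_def by simp
    show "r {0,1,2,5} \<subseteq> {0,1,5}" using cover'[of "{0,1,5}"] unfolding Fs_def by simp
    show "r {1,2,5,6} \<subseteq> {1,2,5} \<or> r {0,1,2,5} \<subseteq> {1,2,5}"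
      using cover'[of "{1,2,5}"] unfolding Fs_def by simp
    show "\<not> r {1,2,6,9} \<subseteq> {2,6}" "\<not> r {1,2,5,6} \<subseteq> {2,6}"
      using avoid unfolding fX Fs_def by simp_all
    show "\<not> (r {0,2,5,6} \<subseteq> {5,6} \<and> r {1,5,6,9} \<subseteq> {5,6})"
      by (rule unique') (simp_all add: Fs_def set_eq_subset)
  qed simp
  \<comment> \<open>The image of the previous half under the automorphism, which fixes 1, 5 and
    9.\<close>
  moreover have "r {1,4,5,8} \<subseteq> {1,5} \<or> r {1,4,5,7} \<subseteq> {1,5}"
  proof (rule half_covers_edge[of 7 1 4 5 8 9 "r {1,4,8,9}" _ "r {4,5,7,8}" "r {1,5,8,9}"])
    show "r {1,4,8,9} \<subseteq> {4,8,9}" using cover'[of "{4,8,9}"] unfolding Fs_def by simp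
    show "r {1,4,8,9} \<subseteq> {1,4,8} \<or> r {1,4,5,8} \<subseteq> {1,4,8}"
      using cover'[of "{1,4,8}"] unfolding Fs_def by simp
    show "r {1,4,5,8} \<subseteq> {4,5,8} \<or> r {4,5,7,8} \<subseteq> {4,5,8}"
      using cover'[of "{4,5,8}"] unfolding Fs_def by simp
    show "r {4,5,7,8} \<subseteq> {7,5,8}" using cover'[of "{7,5,8}"] unfolding Fs_def by simp
    show "r {1,5,8,9} \<subseteq> {5,8,9}" using cover'[of "{5,8,9}"] unfolding Fs_def by simp
    show "r {1,5,8,9} \<subseteq> {1,5,8} \<or> r {1,4,5,8} \<subseteq> {1,5,8}"
      using cover'[of "{1,5,8}"] unfolding Fs_def by simp
    show "r {1,4,5,7} \<subseteq> {7,1,5}" using cover'[of "{7,1,5}"] unfolding Fs_def by simp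
    show "r {1,4,5,8} \<subseteq> {1,4,5} \<or> r {1,4,5,7} \<subseteq> {1,4,5}"
      using cover'[of "{1,4,5}"] unfolding Fs_def by simp
    show "\<not> r {1,4,8,9} \<subseteq> {4,8}" "\<not> r {1,4,5,8} \<subseteq> {4,8}"
      using avoid unfolding fX Fs_def by simp_all
    show "\<not> (r {4,5,7,8} \<subseteq> {5,8} \<and> r {1,5,8,9} \<subseteq> {5,8})"
      by (rule unique') (simp_all add: Fs_def set_eq_subset)
  qed simp
  \<comment> \<open>Whichever facet covers the edge \<open>15\<close> in each half, the two facets
    are distinct, so their intervals would overlap in \<open>15\<close>.\<close>
  moreover have "\<not> (r {1,2,5,6} \<subseteq> {1,5} \<and> r {1,4,5,8} \<subseteq> {1,5})"
    "\<not> (r {1,2,5,6} \<subseteq> {1,5} \<and> r {1,4,5,7} \<subseteq> {1,5})"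
    "\<not> (r {0,1,2,5} \<subseteq> {1,5} \<and> r {1,4,5,8} \<subseteq> {1,5})"
    "\<not> (r {0,1,2,5} \<subseteq> {1,5} \<and> r {1,4,5,7} \<subseteq> {1,5})"
    by (rule unique'; simp add: Fs_def set_eq_subset)+
  ultimately show False
    by argo
qed

theorem mainTheorem5:
  shows "constructible complex_C3 \<and> \<not> partitionable complex_C3 \<and>
    \<not> (\<forall>D :: (nat \<times> nat) set set.
          simplicial_complex D \<and> constructible D \<longrightarrow> partitionable D)"
  using constructible_C3 not_partitionable_C3 simplicial_complex_C3 by blast

end
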